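(* Let $A$ be a finite set of size $q \geq 2$, and let $D_\infty = \langle x,y \mid x^2 = y^2 = \mathrm{id} \rangle$ be the infinite dihedral group. Then the monoid $\mathrm{CA}(D_\infty ; A)$ is not finitely generated.
   Context: For a group $G$ and a finite set $A$, $A^G$ is the set of all functions $x : G \to A$, with the shift action $(g\cdot x)(h) = x(g^{-1}h)$. A cellular automaton over $A^G$ is a map $\tau : A^G \to A^G$ for which there exist a finite subset $S \subseteq G$ and a function $\mu : A^S \to A$ such that $\tau(x)(g) = \mu((g^{-1}\cdot x)|_S)$ for all $x \in A^G$, $g\in G$. $\mathrm{CA}(G;A)$ is the monoid of all cellular automata over $A^G$ under composition. A monoid is finitely generated if it is generated, as a monoid, by a finite subset. *)

theory Defs
  imports "HOL-Algebra.Group"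
begin

section \<open>Group presentations\<close>

text \<open>
  A letter \<open>(a, True)\<close> of a word stands for the generator \<open>a\<close>,
  and \<open>(a, False)\<close> for its formal inverse.
\<close>

type_synonym 'a gword = "('a \<times> bool) list"

inductive gword_eq :: "'a gword set \<Rightarrow> 'a gword \<Rightarrow> 'a gword \<Rightarrow> bool" for R where
  cancel: "gword_eq R (u @ [(a, b), (a, \<not> b)] @ v) (u @ v)"
| relator: "r \<in> R \<Longrightarrow> gword_eq R (u @ r @ v) (u @ v)"
| refl: "gword_eq R u u"
| sym: "gword_eq R u v \<Longrightarrow> gword_eq R v u"
| trans: "gword_eq R u v \<Longrightarrow> gword_eq R v w \<Longrightarrow> gword_eq R u w"

definition gword_rel :: "'a gword set \<Rightarrow> ('a gword \<times> 'a gword) set" where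
  "gword_rel R = {(u, v). gword_eq R u v}"

text \<open>The group presented by all elements of the type \<open>'a\<close> as generators and \<open>R\<close> as relators.\<close>

definition presented_group :: "'a gword set \<Rightarrow> 'a gword set monoid" where
  "presented_group R =
    \<lparr>carrier = UNIV // gword_rel R,
     mult = (\<lambda>U V. \<Union>u\<in>U. \<Union>v\<in>V. gword_rel R `` {u @ v}),
     one = gword_rel R `` {[]}\<rparr>"

lemma equiv_gword_rel: "equiv UNIV (gword_rel R)"
  by (auto simp: gword_rel_def intro!: equivI refl_onI symI transI
      intro: gword_eq.refl gword_eq.sym gword_eq.trans)

lemma gword_eq_append_left: "gword_eq R u v \<Longrightarrow> gword_eq R (w @ u) (w @ v)"
proof (induction rule: gword_eq.induct)
  case (cancel u a b v)
  then show ?case using gword_eq.cancel[of R "w @ u" a b v] by simp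
next
  case (relator r u v)
  then show ?case using gword_eq.relator[of r R "w @ u" v] by simp
qed (auto intro: gword_eq.refl gword_eq.sym gword_eq.trans)

lemma gword_eq_append_right: "gword_eq R u v \<Longrightarrow> gword_eq R (u @ w) (v @ w)"
proof (induction rule: gword_eq.induct)
  case (cancel u a b v)
  then show ?case using gword_eq.cancel[of R u a b "v @ w"] by simp
next
  case (relator r u v)
  then show ?case using gword_eq.relator[of r R u "v @ w"] by simp
qed (auto intro: gword_eq.refl gword_eq.sym gword_eq.trans)

lemma gword_eq_append:
  "gword_eq R u u' \<Longrightarrow> gword_eq R v v' \<Longrightarrow> gword_eq R (u @ v) (u' @ v')"
  by (meson gword_eq.trans gword_eq_append_left gword_eq_append_right)

lemma presented_group_mult_class:
  "gword_rel R `` {u} \<otimes>\<^bsub>presented_group R\<^esub> gword_rel R `` {v} = gword_rel R `` {u @ v}"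
proof -
  have "(\<lambda>u v. gword_rel R `` {u @ v}) respects2 gword_rel R"
    by (rule congruent2I', rule equiv_class_eq[OF equiv_gword_rel])
       (simp add: gword_rel_def gword_eq_append)
  then show ?thesis
    unfolding presented_group_def
    using UN_equiv_class2[OF equiv_gword_rel equiv_gword_rel, of R R] by simp
qed

lemma gword_eq_inverse:
  "gword_eq R (rev (map (\<lambda>(a, b). (a, \<not> b)) w) @ w) []"
proof (induction w)
  case Nil
  show ?case by (simp add: gword_eq.refl)
next
  case (Cons c w)
  obtain a b where c: "c = (a, b)" by (cases c)
  show ?case
    using gword_eq.cancel[of R "rev (map (\<lambda>(a, b). (a, \<not> b)) w)" a "\<not> b" w] Cons
    by (auto simp: c intro: gword_eq.trans)
qed

lemma group_presented_group: "group (presented_group R)"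
proof (rule groupI)
  have carr: "\<exists>u. U = gword_rel R `` {u}" if "U \<in> carrier (presented_group R)" for U
    using that by (auto simp: presented_group_def elim: quotientE)
  have carr': "gword_rel R `` {u} \<in> carrier (presented_group R)" for u
    by (simp add: presented_group_def quotientI)
  have one: "\<one>\<^bsub>presented_group R\<^esub> = gword_rel R `` {[]}"
    by (simp add: presented_group_def)
  let ?G = "presented_group R"
  show "\<one>\<^bsub>?G\<^esub> \<in> carrier ?G"
    by (simp add: one carr')
  show "x \<otimes>\<^bsub>?G\<^esub> y \<in> carrier ?G" if "x \<in> carrier ?G" "y \<in> carrier ?G" for x y
    using carr[OF that(1)] carr[OF that(2)] by (auto simp: presented_group_mult_class carr')
  show "x \<otimes>\<^bsub>?G\<^esub> y \<otimes>\<^bsub>?G\<^esub> z = x \<otimes>\<^bsub>?G\<^esub> (y \<otimes>\<^bsub>?G\<^esub> z)"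
    if "x \<in> carrier ?G" "y \<in> carrier ?G" "z \<in> carrier ?G" for x y z
    using carr[OF that(1)] carr[OF that(2)] carr[OF that(3)]
    by (auto simp: presented_group_mult_class)
  show "\<one>\<^bsub>?G\<^esub> \<otimes>\<^bsub>?G\<^esub> x = x" if "x \<in> carrier ?G" for x
    using carr[OF that] by (auto simp: one presented_group_mult_class)
  show "\<exists>y\<in>carrier ?G. y \<otimes>\<^bsub>?G\<^esub> x = \<one>\<^bsub>?G\<^esub>" if x: "x \<in> carrier ?G" for x
  proof -
    obtain w where w: "x = gword_rel R `` {w}" using carr[OF x] by blast
    let ?i = "rev (map (\<lambda>(a, b). (a, \<not> b)) w)"
    have "gword_rel R `` {?i @ w} = gword_rel R `` {[]}"
      by (rule equiv_class_eq[OF equiv_gword_rel]) (simp add: gword_rel_def gword_eq_inverse)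
    then have "gword_rel R `` {?i} \<otimes>\<^bsub>?G\<^esub> x = \<one>\<^bsub>?G\<^esub>"
      by (simp only: w one presented_group_mult_class)
    then show ?thesis using carr' by blast
  qed
qed


section \<open>The infinite dihedral group\<close>

datatype dih_gen = Gen_x | Gen_y

definition D_infinity :: "dih_gen gword set monoid" where
  "D_infinity = presented_group {[(Gen_x, True), (Gen_x, True)], [(Gen_y, True), (Gen_y, True)]}"

lemma group_D_infinity: "group D_infinity"
  unfolding D_infinity_def by (rule group_presented_group)


section \<open>Cellular automata\<close>

definition configs :: "('g, 'm) monoid_scheme \<Rightarrow> 'a set \<Rightarrow> ('g \<Rightarrow> 'a) set" where
  "configs G A = carrier G \<rightarrow>\<^sub>E A"

definition shift :: "('g, 'm) monoid_scheme \<Rightarrow> 'g \<Rightarrow> ('g \<Rightarrow> 'a) \<Rightarrow> ('g \<Rightarrow> 'a)" where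
  "shift G g x = (\<lambda>h\<in>carrier G. x (inv\<^bsub>G\<^esub> g \<otimes>\<^bsub>G\<^esub> h))"

definition cellular_automaton ::
  "('g, 'm) monoid_scheme \<Rightarrow> 'a set \<Rightarrow> (('g \<Rightarrow> 'a) \<Rightarrow> ('g \<Rightarrow> 'a)) \<Rightarrow> bool" where
  "cellular_automaton G A \<tau> \<longleftrightarrow>
    \<tau> \<in> configs G A \<rightarrow>\<^sub>E configs G A \<and>
    (\<exists>S \<mu>. finite S \<and> S \<subseteq> carrier G \<and> \<mu> \<in> (S \<rightarrow>\<^sub>E A) \<rightarrow> A \<and>
      (\<forall>x\<in>configs G A. \<forall>g\<in>carrier G. \<tau> x g = \<mu> (restrict (shift G (inv\<^bsub>G\<^esub> g) x) S)))"

definition CA :: "('g, 'm) monoid_scheme \<Rightarrow> 'a set \<Rightarrow> (('g \<Rightarrow> 'a) \<Rightarrow> ('g \<Rightarrow> 'a)) monoid" where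
  "CA G A =
    \<lparr>carrier = {\<tau>. cellular_automaton G A \<tau>},
     mult = (\<lambda>\<sigma> \<tau>. compose (configs G A) \<sigma> \<tau>),
     one = (\<lambda>x\<in>configs G A. x)\<rparr>"

lemma shift_closed:
  assumes "group G" "g \<in> carrier G" "x \<in> configs G A"
  shows "shift G g x \<in> configs G A"
proof -
  interpret group G by fact
  show ?thesis using assms by (auto simp: configs_def shift_def)
qed

lemma cellular_automaton_id:
  assumes "group G"
  shows "cellular_automaton G A (\<lambda>x\<in>configs G A. x)"
proof -
  interpret group G by fact
  show ?thesis
    unfolding cellular_automaton_def
  proof (intro conjI exI)
    show "finite {\<one>\<^bsub>G\<^esub>}" "{\<one>\<^bsub>G\<^esub>} \<subseteq> carrier G" by simp_all
    show "(\<lambda>y. y \<one>\<^bsub>G\<^esub>) \<in> ({\<one>\<^bsub>G\<^esub>} \<rightarrow>\<^sub>E A) \<rightarrow> A" by auto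
  qed (auto simp: shift_def)
qed

lemma cellular_automaton_compose:
  fixes G (structure)
  assumes "group G" and \<sigma>: "cellular_automaton G A \<sigma>" and \<tau>: "cellular_automaton G A \<tau>"
  shows "cellular_automaton G A (compose (configs G A) \<sigma> \<tau>)"
proof -
  interpret group G by fact
  from \<sigma> obtain S \<mu> where \<sigma>C: "\<sigma> \<in> configs G A \<rightarrow>\<^sub>E configs G A"
    and S: "finite S" "S \<subseteq> carrier G" and \<mu>: "\<mu> \<in> (S \<rightarrow>\<^sub>E A) \<rightarrow> A"
    and \<sigma>eq: "\<And>x g. x \<in> configs G A \<Longrightarrow> g \<in> carrier G \<Longrightarrow>
      \<sigma> x g = \<mu> (restrict (shift G (inv g) x) S)"
    unfolding cellular_automaton_def by blast
  from \<tau> obtain T \<nu> where \<tau>C: "\<tau> \<in> configs G A \<rightarrow>\<^sub>E configs G A"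
    and T: "finite T" "T \<subseteq> carrier G" and \<nu>: "\<nu> \<in> (T \<rightarrow>\<^sub>E A) \<rightarrow> A"
    and \<tau>eq: "\<And>x g. x \<in> configs G A \<Longrightarrow> g \<in> carrier G \<Longrightarrow>
      \<tau> x g = \<nu> (restrict (shift G (inv g) x) T)"
    unfolding cellular_automaton_def by blast
  let ?P = "(\<lambda>(s, t). s \<otimes> t) ` (S \<times> T)"
  let ?k = "\<lambda>y. \<mu> (\<lambda>s\<in>S. \<nu> (\<lambda>t\<in>T. y (s \<otimes> t)))"
  have C: "\<tau> x \<in> configs G A" if "x \<in> configs G A" for x
    using \<tau>C that by auto
  show ?thesis
    unfolding cellular_automaton_def
  proof (intro conjI exI ballI)
    show "compose (configs G A) \<sigma> \<tau> \<in> configs G A \<rightarrow>\<^sub>E configs G A"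
      using \<sigma>C \<tau>C by (auto simp: compose_def)
    show "finite ?P" using S T by simp
    show "?P \<subseteq> carrier G" using S T by auto
    show "?k \<in> (?P \<rightarrow>\<^sub>E A) \<rightarrow> A"
    proof
      fix y assume y: "y \<in> ?P \<rightarrow>\<^sub>E A"
      have "(\<lambda>t\<in>T. y (s \<otimes> t)) \<in> T \<rightarrow>\<^sub>E A" if "s \<in> S" for s
        using y that by (auto simp: PiE_iff)
      then have "(\<lambda>s\<in>S. \<nu> (\<lambda>t\<in>T. y (s \<otimes> t))) \<in> S \<rightarrow>\<^sub>E A"
        using \<nu> by (auto simp: Pi_iff)
      then show "?k y \<in> A" using \<mu> by (auto simp: Pi_iff)
    qed
    fix x g assume x: "x \<in> configs G A" and g: "g \<in> carrier G"
    have "restrict (shift G (inv g) (\<tau> x)) S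
        = (\<lambda>s\<in>S. \<nu> (\<lambda>t\<in>T. restrict (shift G (inv g) x) ?P (s \<otimes> t)))"
    proof
      fix s
      show "restrict (shift G (inv g) (\<tau> x)) S s
        = (\<lambda>s\<in>S. \<nu> (\<lambda>t\<in>T. restrict (shift G (inv g) x) ?P (s \<otimes> t))) s"
      proof (cases "s \<in> S")
        case True
        then have s: "s \<in> carrier G" using S by auto
        have "restrict (shift G (inv (g \<otimes> s)) x) T
            = (\<lambda>t\<in>T. restrict (shift G (inv g) x) ?P (s \<otimes> t))"
        proof
          fix t
          show "restrict (shift G (inv (g \<otimes> s)) x) T t
            = (\<lambda>t\<in>T. restrict (shift G (inv g) x) ?P (s \<otimes> t)) t"
          proof (cases "t \<in> T")
            case t: True
            then have "t \<in> carrier G" using T by auto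
            moreover have "s \<otimes> t \<in> ?P" using t \<open>s \<in> S\<close> by force
            ultimately show ?thesis
              using t s g by (simp add: shift_def m_assoc)
          qed simp
        qed
        then show ?thesis
          using True s g x by (simp add: shift_def[of G "inv g" "\<tau> x"] \<tau>eq)
      qed simp
    qed
    then show "compose (configs G A) \<sigma> \<tau> x g = ?k (restrict (shift G (inv g) x) ?P)"
      using x g C by (simp add: compose_def \<sigma>eq)
  qed
qed

lemma monoid_CA:
  assumes "group G"
  shows "monoid (CA G A)"
proof (rule monoidI)
  have PiE: "\<tau> \<in> configs G A \<rightarrow>\<^sub>E configs G A" if "\<tau> \<in> carrier (CA G A)" for \<tau>
    using that by (simp add: CA_def cellular_automaton_def)
  show "\<one>\<^bsub>CA G A\<^esub> \<in> carrier (CA G A)"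
    by (simp add: CA_def cellular_automaton_id[OF assms])
  show "\<sigma> \<otimes>\<^bsub>CA G A\<^esub> \<tau> \<in> carrier (CA G A)"
    if "\<sigma> \<in> carrier (CA G A)" "\<tau> \<in> carrier (CA G A)" for \<sigma> \<tau>
    using that by (simp add: CA_def cellular_automaton_compose[OF assms])
  show "\<rho> \<otimes>\<^bsub>CA G A\<^esub> \<sigma> \<otimes>\<^bsub>CA G A\<^esub> \<tau> = \<rho> \<otimes>\<^bsub>CA G A\<^esub> (\<sigma> \<otimes>\<^bsub>CA G A\<^esub> \<tau>)"
    if "\<rho> \<in> carrier (CA G A)" "\<sigma> \<in> carrier (CA G A)" "\<tau> \<in> carrier (CA G A)" for \<rho> \<sigma> \<tau>
    using PiE[OF that(3)] by (auto simp: CA_def compose_def PiE_iff restrict_def fun_eq_iff)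
  show "\<one>\<^bsub>CA G A\<^esub> \<otimes>\<^bsub>CA G A\<^esub> \<tau> = \<tau>" if "\<tau> \<in> carrier (CA G A)" for \<tau>
    using PiE[OF that]
    by (auto simp: CA_def compose_def PiE_iff restrict_def fun_eq_iff extensional_def)
  show "\<tau> \<otimes>\<^bsub>CA G A\<^esub> \<one>\<^bsub>CA G A\<^esub> = \<tau>" if "\<tau> \<in> carrier (CA G A)" for \<tau>
    using PiE[OF that]
    by (auto simp: CA_def compose_def PiE_iff restrict_def fun_eq_iff extensional_def)
qed


section \<open>Finitely generated monoids\<close>

definition generated_submonoid :: "('m, 'b) monoid_scheme \<Rightarrow> 'm set \<Rightarrow> 'm set" where
  "generated_submonoid M S = \<Inter>{H. submonoid H M \<and> S \<subseteq> H}"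

definition finitely_generated_monoid :: "('m, 'b) monoid_scheme \<Rightarrow> bool" where
  "finitely_generated_monoid M \<longleftrightarrow>
    (\<exists>S. finite S \<and> S \<subseteq> carrier M \<and> generated_submonoid M S = carrier M)"

end

theory Submission
  imports Defs "HOL-Algebra.Coset"
begin

text \<open>
  The argument applies to every group \<open>G\<close> with infinitely many normal subgroups of finite index;
  for \<open>D\<^sub>\<infinity>\<close> these are the kernels of its maps onto the finite dihedral groups.
  Suppose \<open>X\<close> is a finite generating set. Take more than \<open>|X|\<close> proper normal subgroups \<open>H\<close> of finite
  index, with intersection \<open>N\<close>, and let all cellular automata act on the finite set \<open>P\<close> of
  \<open>N\<close>-periodic configurations. An automaton that is injective on \<open>P\<close> permutes \<open>P\<close> and preserves
  stabilizers. Hence the automata that are injective on \<open>P\<close>, or that identify two distinct points of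
  \<open>P\<close> whose stabilizers do not satisfy \<open>H \<in> {Stab x, Stab y} \<subseteq> {H, G}\<close>, form a submonoid. The
  automaton collapsing all points of \<open>P\<close> with stabilizer \<open>H\<close> to a constant configuration lies
  outside it, so some element of \<open>X\<close> does as well. That element determines \<open>H\<close>, which contradicts
  the choice of more than \<open>|X|\<close> subgroups.
\<close>

section \<open>Periodic configurations and their stabilizers\<close>

definition shift_stabilizer :: "('g, 'm) monoid_scheme \<Rightarrow> ('g \<Rightarrow> 'a) \<Rightarrow> 'g set" where
  "shift_stabilizer G x = {g \<in> carrier G. shift G g x = x}"

text \<open>For a normal subgroup \<open>N\<close> these are the configurations constant on the
  right cosets of \<open>N\<close>, that is, functions on the quotient by \<open>N\<close>. Stating
  this through stabilizers makes invariance under automata immediate.\<close>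

definition periodic_configs ::
  "('g, 'm) monoid_scheme \<Rightarrow> 'a set \<Rightarrow> 'g set \<Rightarrow> ('g \<Rightarrow> 'a) set" where
  "periodic_configs G A N = {x \<in> configs G A. N \<subseteq> shift_stabilizer G x}"

context group
begin

section \<open>The shift action and the equivariance of cellular automata\<close>

lemma mult_inv_cancel_left:
  assumes "g \<in> carrier G" "h \<in> carrier G"
  shows "g \<otimes> (inv g \<otimes> h) = h" "inv g \<otimes> (g \<otimes> h) = h"
  using assms by (simp_all flip: m_assoc)

lemma shift_shift:
  assumes "g \<in> carrier G" "h \<in> carrier G"
  shows "shift G g (shift G h x) = shift G (g \<otimes> h) x"
  using assms by (auto simp: shift_def restrict_def inv_mult_group m_assoc)

lemma shift_one:
  assumes "x \<in> configs G A"
  shows "shift G \<one> x = x"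
proof
  show "shift G \<one> x h = x h" for h
    using assms by (cases "h \<in> carrier G") (auto simp: shift_def configs_def PiE_iff extensional_def)
qed

lemma shift_inv_shift:
  assumes "x \<in> configs G A" "g \<in> carrier G"
  shows "shift G (inv g) (shift G g x) = x"
  using assms by (simp add: shift_shift shift_one)

lemma cellular_automaton_closed:
  "cellular_automaton G A \<tau> \<Longrightarrow> x \<in> configs G A \<Longrightarrow> \<tau> x \<in> configs G A"
  by (auto simp: cellular_automaton_def)

text \<open>The local rule at \<open>h\<close> sees only the argument shifted by
  \<open>inv h\<close>, and shifting \<open>shift G g x\<close> by \<open>inv h\<close> is the same
  as shifting \<open>x\<close> by \<open>inv (inv g \<otimes> h)\<close>.\<close>

lemma cellular_automaton_shift:
  assumes \<tau>: "cellular_automaton G A \<tau>" and x: "x \<in> configs G A" and g: "g \<in> carrier G"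
  shows "\<tau> (shift G g x) = shift G g (\<tau> x)"
proof -
  obtain S \<mu> where \<mu>: "\<And>x h. x \<in> configs G A \<Longrightarrow> h \<in> carrier G \<Longrightarrow>
      \<tau> x h = \<mu> (restrict (shift G (inv h) x) S)"
    using \<tau> unfolding cellular_automaton_def by blast
  note sx = shift_closed[OF is_group g x]
  show ?thesis
  proof
    fix h
    show "\<tau> (shift G g x) h = shift G g (\<tau> x) h"
    proof (cases "h \<in> carrier G")
      case True
      then have "inv (inv g \<otimes> h) = inv h \<otimes> g" using g by (simp add: inv_mult_group)
      then show ?thesis
        using True g x sx by (simp add: \<mu> shift_def[of G g "\<tau> x"] shift_shift)
    next
      case False
      then show ?thesis
        using cellular_automaton_closed[OF \<tau> sx] by (auto simp: shift_def configs_def PiE_iff extensional_def)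
    qed
  qed
qed

section \<open>Stabilizers under shifts and under automata\<close>

lemma shift_stabilizer_shift_iff:
  assumes "x \<in> configs G A" "g \<in> carrier G" "h \<in> carrier G"
  shows "h \<in> shift_stabilizer G (shift G g x) \<longleftrightarrow> inv g \<otimes> h \<otimes> g \<in> shift_stabilizer G x"
proof
  assume "h \<in> shift_stabilizer G (shift G g x)"
  then have "shift G (inv g) (shift G h (shift G g x)) = shift G (inv g) (shift G g x)"
    by (simp add: shift_stabilizer_def)
  then show "inv g \<otimes> h \<otimes> g \<in> shift_stabilizer G x"
    using assms by (simp add: shift_stabilizer_def shift_shift shift_one m_assoc)
next
  assume "inv g \<otimes> h \<otimes> g \<in> shift_stabilizer G x"
  then have "shift G g (shift G (inv g \<otimes> h \<otimes> g) x) = shift G g x"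
    by (simp add: shift_stabilizer_def)
  moreover have "g \<otimes> (inv g \<otimes> h \<otimes> g) = h \<otimes> g"
    using assms by (simp add: m_assoc mult_inv_cancel_left)
  ultimately show "h \<in> shift_stabilizer G (shift G g x)"
    using assms by (simp add: shift_stabilizer_def shift_shift)
qed

text \<open>Stabilizers along an orbit are conjugate, so a normal one is constant on the
  orbit.\<close>

lemma shift_stabilizer_shift_normal:
  assumes x: "x \<in> configs G A" and g: "g \<in> carrier G" and N: "shift_stabilizer G x \<lhd> G"
  shows "shift_stabilizer G (shift G g x) = shift_stabilizer G x"
proof -
  have "inv g \<otimes> h \<otimes> g \<in> shift_stabilizer G x \<longleftrightarrow> h \<in> shift_stabilizer G x"
    if h: "h \<in> carrier G" for h
  proof
    assume "inv g \<otimes> h \<otimes> g \<in> shift_stabilizer G x"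
    then have "g \<otimes> (inv g \<otimes> h \<otimes> g) \<otimes> inv g \<in> shift_stabilizer G x"
      using normal.inv_op_closed2[OF N] g by blast
    then show "h \<in> shift_stabilizer G x"
      using g h by (simp add: m_assoc mult_inv_cancel_left)
  qed (use normal.inv_op_closed1[OF N] g in blast)
  then show ?thesis
    using shift_stabilizer_shift_iff[OF x g] by (auto simp: shift_stabilizer_def)
qed

lemma periodic_configs_shift:
  assumes N: "N \<lhd> G" and x: "x \<in> periodic_configs G A N" and g: "g \<in> carrier G"
  shows "shift G g x \<in> periodic_configs G A N"
proof -
  interpret N: normal N G by fact
  have xc: "x \<in> configs G A" and xN: "N \<subseteq> shift_stabilizer G x"
    using x by (simp_all add: periodic_configs_def)
  have "h \<in> shift_stabilizer G (shift G g x)" if h: "h \<in> N" for h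
  proof -
    have "inv g \<otimes> h \<otimes> g \<in> shift_stabilizer G x"
      using N.inv_op_closed1[OF g h] xN by blast
    then show ?thesis
      using shift_stabilizer_shift_iff[OF xc g N.mem_carrier[OF h]] by simp
  qed
  then show ?thesis
    using shift_closed[OF is_group g xc] by (simp add: periodic_configs_def subsetI)
qed

lemma shift_stabilizer_image:
  assumes "cellular_automaton G A \<tau>" "x \<in> configs G A"
  shows "shift_stabilizer G x \<subseteq> shift_stabilizer G (\<tau> x)"
  by (auto simp: shift_stabilizer_def simp flip: cellular_automaton_shift[OF assms])

lemma periodic_configs_image:
  assumes "cellular_automaton G A \<tau>" "x \<in> periodic_configs G A N"
  shows "\<tau> x \<in> periodic_configs G A N"
  using assms shift_stabilizer_image[of A \<tau> x] cellular_automaton_closed[of A \<tau> x]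
  by (auto simp: periodic_configs_def)

text \<open>If \<open>g\<close> fixes \<open>\<tau> x\<close>, then by equivariance
  \<open>\<tau>\<close> agrees on \<open>x\<close> and \<open>shift G g x\<close>. Both are
  \<open>N\<close>-periodic since \<open>N\<close> is normal, so injectivity gives that
  \<open>g\<close> fixes \<open>x\<close>.\<close>

lemma shift_stabilizer_image_inj:
  assumes "N \<lhd> G" and \<tau>: "cellular_automaton G A \<tau>" "inj_on \<tau> (periodic_configs G A N)"
    and x: "x \<in> periodic_configs G A N"
  shows "shift_stabilizer G (\<tau> x) = shift_stabilizer G x"
proof
  have xc: "x \<in> configs G A" using x by (simp add: periodic_configs_def)
  show "shift_stabilizer G x \<subseteq> shift_stabilizer G (\<tau> x)"
    using shift_stabilizer_image \<tau> xc by blast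
  show "shift_stabilizer G (\<tau> x) \<subseteq> shift_stabilizer G x"
  proof
    fix g assume g: "g \<in> shift_stabilizer G (\<tau> x)"
    then have "\<tau> (shift G g x) = \<tau> x"
      using cellular_automaton_shift[OF \<tau>(1) xc] by (simp add: shift_stabilizer_def)
    then have "shift G g x = x"
      using g x periodic_configs_shift[OF assms(1) x] inj_onD[OF \<tau>(2)]
      by (auto simp: shift_stabilizer_def)
    then show "g \<in> shift_stabilizer G x" using g by (simp add: shift_stabilizer_def)
  qed
qed

section \<open>Finiteness of the periodic configurations and extension of equivariant maps\<close>

text \<open>If \<open>g \<otimes> inv s\<close> lies in \<open>N\<close>, it fixes every
  \<open>N\<close>-periodic \<open>z\<close>, hence \<open>z g = z s\<close>. Thus the values on
  \<open>S\<close> determine \<open>z\<close> everywhere.\<close>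

lemma inj_on_restrict_periodic_configs:
  assumes S: "S \<subseteq> carrier G" and NS: "\<And>g. g \<in> carrier G \<Longrightarrow> \<exists>s\<in>S. g \<otimes> inv s \<in> N"
  shows "inj_on (\<lambda>x. restrict x S) (periodic_configs G A N)"
proof (rule inj_onI, rule ext)
  fix x y g
  assume x: "x \<in> periodic_configs G A N" and y: "y \<in> periodic_configs G A N"
    and eq: "restrict x S = restrict y S"
  have *: "z g = z s" if z: "z \<in> periodic_configs G A N" and g: "g \<in> carrier G"
    and s: "s \<in> S" "g \<otimes> inv s \<in> N" for z s
  proof -
    have s': "s \<in> carrier G" using S s by blast
    have "z g = shift G (g \<otimes> inv s) z g"
      using z s by (auto simp: periodic_configs_def shift_stabilizer_def)
    also have "\<dots> = z s" using g s' by (simp add: shift_def inv_mult_group m_assoc)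
    finally show ?thesis .
  qed
  show "x g = y g"
  proof (cases "g \<in> carrier G")
    case True
    then obtain s where s: "s \<in> S" "g \<otimes> inv s \<in> N" using NS by blast
    have "x s = y s" using fun_cong[OF eq, of s] s by simp
    then show ?thesis using *[OF x True s] *[OF y True s] by simp
  next
    case False
    then show ?thesis
      using x y by (simp add: periodic_configs_def configs_def PiE_iff extensional_def)
  qed
qed

lemma finite_periodic_configs:
  assumes "finite A" "finite S" "S \<subseteq> carrier G"
    and "\<And>g. g \<in> carrier G \<Longrightarrow> \<exists>s\<in>S. g \<otimes> inv s \<in> N"
  shows "finite (periodic_configs G A N)"
proof (rule inj_on_finite)
  show "inj_on (\<lambda>x. restrict x S) (periodic_configs G A N)"
    using assms inj_on_restrict_periodic_configs by blast
  show "(\<lambda>x. restrict x S) ` periodic_configs G A N \<subseteq> S \<rightarrow>\<^sub>E A"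
    using assms by (auto simp: periodic_configs_def configs_def PiE_iff)
  show "finite (S \<rightarrow>\<^sub>E A)" using assms by (intro finite_PiE) auto
qed

text \<open>An \<open>N\<close>-periodic \<open>x\<close> can be recovered from its pattern on
  \<open>S\<close>, so \<open>F x \<one>\<close> is a function of that pattern and serves as a local
  rule with memory set \<open>S\<close>. Equivariance of \<open>F\<close> carries the agreement at
  \<open>\<one>\<close> to every \<open>g\<close>.\<close>

lemma ex_cellular_automaton_extending:
  assumes N: "N \<lhd> G" and S: "finite S" "S \<subseteq> carrier G"
    and NS: "\<And>g. g \<in> carrier G \<Longrightarrow> \<exists>s\<in>S. g \<otimes> inv s \<in> N"
    and a: "a \<in> A"
    and F: "\<And>x. x \<in> periodic_configs G A N \<Longrightarrow> F x \<in> configs G A"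
    and eqv: "\<And>g x. g \<in> carrier G \<Longrightarrow> x \<in> periodic_configs G A N \<Longrightarrow>
      F (shift G g x) = shift G g (F x)"
  shows "\<exists>\<tau>. cellular_automaton G A \<tau> \<and> (\<forall>x\<in>periodic_configs G A N. \<tau> x = F x)"
proof -
  let ?P = "periodic_configs G A N" and ?r = "\<lambda>x. restrict x S"
  \<comment> \<open>Patterns that come from no periodic configuration get the arbitrary value
    \<open>a\<close>, which only keeps the rule inside \<open>A\<close>.\<close>
  define \<mu> where "\<mu> f = (if f \<in> ?r ` ?P then F (inv_into ?P ?r f) \<one> else a)" for f
  define \<tau> where "\<tau> = (\<lambda>x\<in>configs G A. \<lambda>g\<in>carrier G. \<mu> (?r (shift G (inv g) x)))"
  have inj: "inj_on ?r ?P" using S(2) NS by (rule inj_on_restrict_periodic_configs)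
  have \<mu>A: "\<mu> f \<in> A" for f
  proof (cases "f \<in> ?r ` ?P")
    case True
    then have "F (inv_into ?P ?r f) \<in> configs G A" using F inv_into_into by metis
    then show ?thesis using True by (auto simp: \<mu>_def configs_def)
  qed (simp add: \<mu>_def a)
  have \<mu>P: "\<mu> (?r x) = F x \<one>" if "x \<in> ?P" for x
    using that inv_into_f_f[OF inj] by (simp add: \<mu>_def)
  have "\<tau> \<in> configs G A \<rightarrow>\<^sub>E configs G A"
    using \<mu>A by (auto simp: \<tau>_def configs_def)
  then have "cellular_automaton G A \<tau>"
    unfolding cellular_automaton_def using S \<mu>A
    by (intro conjI exI[of _ S] exI[of _ \<mu>]) (auto simp: \<tau>_def)
  moreover have "\<tau> x = F x" if x: "x \<in> ?P" for x
  proof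
    fix g
    have xc: "x \<in> configs G A" using x by (simp add: periodic_configs_def)
    show "\<tau> x g = F x g"
    proof (cases "g \<in> carrier G")
      case True
      have "\<tau> x g = \<mu> (?r (shift G (inv g) x))" using True xc by (simp add: \<tau>_def)
      also have "\<dots> = F (shift G (inv g) x) \<one>"
        using True by (intro \<mu>P periodic_configs_shift N x) simp
      also have "\<dots> = F x g" using True x by (simp add: eqv shift_def[of G "inv g" "F x"])
      finally show ?thesis .
    next
      case False
      then show ?thesis using xc F[OF x] by (simp add: \<tau>_def configs_def PiE_iff extensional_def)
    qed
  qed
  ultimately show ?thesis by blast
qed

text \<open>The two-valued indicator of \<open>H\<close> works: a left translate of \<open>H\<close>
  equals \<open>H\<close> exactly when the translating element lies in \<open>H\<close>.\<close>

lemma ex_config_shift_stabilizer: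
  assumes "a \<in> A" "b \<in> A" "a \<noteq> b" and H: "subgroup H G"
  shows "\<exists>x\<in>configs G A. shift_stabilizer G x = H"
proof
  interpret H: subgroup H G by fact
  define x where "x = (\<lambda>g\<in>carrier G. if g \<in> H then a else b)"
  show "x \<in> configs G A" using assms by (auto simp: x_def configs_def)
  have "g \<in> H \<longleftrightarrow> shift G g x = x" if g: "g \<in> carrier G" for g
  proof
    assume gH: "g \<in> H"
    have "inv g \<otimes> h \<in> H \<longleftrightarrow> h \<in> H" if h: "h \<in> carrier G" for h
    proof
      assume "inv g \<otimes> h \<in> H"
      then have "g \<otimes> (inv g \<otimes> h) \<in> H" using gH by blast
      then show "h \<in> H" using g h by (simp add: mult_inv_cancel_left)
    qed (use gH in blast)
    then show "shift G g x = x" using g by (auto simp: shift_def x_def)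
  next
    \<comment> \<open>Evaluation at \<open>g\<close> compares \<open>x \<one> = a\<close> with
      \<open>x g\<close>, and \<open>a\<close> is taken only on \<open>H\<close>.\<close>
    assume "shift G g x = x"
    then have "shift G g x g = x g" by simp
    then show "g \<in> H" using g assms by (auto simp: shift_def x_def split: if_splits)
  qed
  then show "shift_stabilizer G x = H"
    using H.subset by (auto simp: shift_stabilizer_def)
qed

section \<open>Groups with infinitely many normal subgroups of finite index\<close>

lemma normal_Inter:
  assumes "\<H> \<noteq> {}" "\<And>H. H \<in> \<H> \<Longrightarrow> H \<lhd> G"
  shows "\<Inter>\<H> \<lhd> G"
  unfolding normal_inv_iff
  using assms normal_inv_iff by (auto intro!: subgroups_Inter)

text \<open>Each \<open>g\<close> determines the tuple of its cosets \<open>H #> g\<close>. Only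
  finitely many tuples occur; one representative for each suffices, since equal tuples put
  \<open>g \<otimes> inv s\<close> into every \<open>H\<close>.\<close>

lemma finite_transversal_Inter:
  assumes fin: "finite \<H>" and H: "\<And>H. H \<in> \<H> \<Longrightarrow> subgroup H G \<and> finite (rcosets H)"
  shows "\<exists>S. finite S \<and> S \<subseteq> carrier G \<and> (\<forall>g\<in>carrier G. \<exists>s\<in>S. g \<otimes> inv s \<in> \<Inter>\<H>)"
proof -
  define c where "c g = (\<lambda>H\<in>\<H>. H #> g)" for g
  have "c ` carrier G \<subseteq> (\<Pi>\<^sub>E H\<in>\<H>. rcosets H)"
    using H by (auto simp: c_def RCOSETS_def)
  moreover have "finite (\<Pi>\<^sub>E H\<in>\<H>. rcosets H)"
    using fin H by (intro finite_PiE) auto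
  ultimately have "finite (c ` carrier G)" by (rule finite_subset)
  then obtain S where S: "S \<subseteq> carrier G" "finite S" "c ` carrier G = c ` S"
    using finite_subset_image[of "c ` carrier G" c "carrier G"] by blast
  have "\<exists>s\<in>S. g \<otimes> inv s \<in> \<Inter>\<H>" if g: "g \<in> carrier G" for g
  proof -
    obtain s where s: "s \<in> S" "c g = c s" using S(3) g by blast
    have sG: "s \<in> carrier G" using s S(1) by blast
    have "g \<otimes> inv s \<in> H" if h: "H \<in> \<H>" for H
    proof -
      have sub: "subgroup H G" using H h by blast
      have "H #> s = H #> g" using fun_cong[OF s(2), of H] h by (simp add: c_def)
      then have "g \<in> H #> s" using rcos_self[OF g sub] by simp
      then show ?thesis using subgroup.rcos_module_imp[OF sub is_group sG] by blast
    qed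
    then show ?thesis using s by blast
  qed
  then show ?thesis using S by blast
qed

section \<open>Submonoids defined by identified pairs, and the counting argument\<close>

lemma generated_submonoid_subset:
  "submonoid H M \<Longrightarrow> S \<subseteq> H \<Longrightarrow> generated_submonoid M S \<subseteq> H"
  by (auto simp: generated_submonoid_def)

text \<open>A pair identified by \<open>\<tau>\<close> stays identified by \<open>\<sigma>\<close>
  after \<open>\<tau>\<close>. If instead \<open>\<tau>\<close> is injective on the finite set of
  periodic configurations, it permutes that set, and a pair identified by \<open>\<sigma>\<close> is
  pulled back along \<open>\<tau>\<close> with unchanged stabilizers. Hence any condition
  \<open>Q\<close> on the two stabilizers is allowed.\<close>

lemma submonoid_kernel_pair:
  assumes N: "N \<lhd> G" and fin: "finite (periodic_configs G A N)"
  shows "submonoid {\<tau>. cellular_automaton G A \<tau> \<and>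
    (inj_on \<tau> (periodic_configs G A N) \<or>
      (\<exists>x\<in>periodic_configs G A N. \<exists>y\<in>periodic_configs G A N.
        x \<noteq> y \<and> \<tau> x = \<tau> y \<and> Q (shift_stabilizer G x) (shift_stabilizer G y)))} (CA G A)"
    (is "submonoid ?H _")
proof
  let ?P = "periodic_configs G A N"
  have P: "x \<in> configs G A" if "x \<in> ?P" for x
    using that by (simp add: periodic_configs_def)
  show "?H \<subseteq> carrier (CA G A)" by (auto simp: CA_def)
  have "inj_on \<one>\<^bsub>CA G A\<^esub> ?P"
    using P by (auto simp: CA_def intro: inj_onI)
  then show "\<one>\<^bsub>CA G A\<^esub> \<in> ?H"
    by (auto simp: CA_def cellular_automaton_id[OF is_group])
  fix \<sigma> \<tau> assume \<sigma>: "\<sigma> \<in> ?H" and \<tau>: "\<tau> \<in> ?H"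
  let ?\<rho> = "\<sigma> \<otimes>\<^bsub>CA G A\<^esub> \<tau>"
  have \<rho>: "?\<rho> x = \<sigma> (\<tau> x)" if "x \<in> ?P" for x
    using that P by (simp add: CA_def compose_def)
  have \<rho>CA: "cellular_automaton G A ?\<rho>"
    using \<sigma> \<tau> by (simp add: CA_def cellular_automaton_compose[OF is_group])
  have into: "\<tau> x \<in> ?P" if "x \<in> ?P" for x
    using that \<tau> periodic_configs_image by blast
  show "?\<rho> \<in> ?H"
  proof (cases "inj_on \<tau> ?P")
    case False
    then obtain x y where "x \<in> ?P" "y \<in> ?P" "x \<noteq> y" "\<tau> x = \<tau> y"
        "Q (shift_stabilizer G x) (shift_stabilizer G y)"
      using \<tau> by blast
    moreover from this have "?\<rho> x = ?\<rho> y" by (simp add: \<rho>)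
    ultimately show ?thesis using \<rho>CA by blast
  next
    case inj: True
    then have surj: "\<tau> ` ?P = ?P"
      using into by (intro endo_inj_surj[OF fin]) auto
    show ?thesis
    proof (cases "inj_on \<sigma> ?P")
      case True
      then have "inj_on ?\<rho> ?P"
        using inj into by (auto simp: inj_on_def \<rho>)
      then show ?thesis using \<rho>CA by simp
    next
      case False
      then obtain u v where uv: "u \<in> ?P" "v \<in> ?P" "u \<noteq> v" "\<sigma> u = \<sigma> v"
          "Q (shift_stabilizer G u) (shift_stabilizer G v)"
        using \<sigma> by blast
      then have "u \<in> \<tau> ` ?P" "v \<in> \<tau> ` ?P" by (simp_all add: surj)
      then obtain x y where xy: "x \<in> ?P" "u = \<tau> x" "y \<in> ?P" "v = \<tau> y"
        by blast
      have "Q (shift_stabilizer G x) (shift_stabilizer G y)"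
        using uv xy \<tau> shift_stabilizer_image_inj[OF N _ inj] by simp
      moreover have "x \<noteq> y" "?\<rho> x = ?\<rho> y" using uv xy by (auto simp: \<rho>)
      ultimately show ?thesis using \<rho>CA xy by blast
    qed
  qed
qed

text \<open>The map \<open>F\<close> sends the points with stabilizer \<open>H\<close> to a constant
  configuration \<open>c\<close> and fixes all others; it is equivariant because normality of
  \<open>H\<close> makes this set of points shift-invariant. Two distinct points with equal image
  either both have stabilizer \<open>H\<close>, or one does and the other is \<open>c\<close>, which
  is fixed by the whole group. The indicator of \<open>H\<close> and \<open>c\<close> form such a
  pair.\<close>

lemma ex_collapsing_cellular_automaton:
  fixes A :: "'c set"
  assumes A: "a \<in> A" "b \<in> A" "a \<noteq> b"
    and N: "N \<lhd> G" and S: "finite S" "S \<subseteq> carrier G"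
    and NS: "\<forall>g\<in>carrier G. \<exists>s\<in>S. g \<otimes> inv s \<in> N"
    and H: "H \<lhd> G" "N \<subseteq> H" "H \<noteq> carrier G"
  shows "\<exists>\<tau>. cellular_automaton G A \<tau> \<and> \<not> inj_on \<tau> (periodic_configs G A N) \<and>
    (\<forall>x\<in>periodic_configs G A N. \<forall>y\<in>periodic_configs G A N. x \<noteq> y \<longrightarrow> \<tau> x = \<tau> y \<longrightarrow>
      H \<in> {shift_stabilizer G x, shift_stabilizer G y} \<and>
      {shift_stabilizer G x, shift_stabilizer G y} \<subseteq> {H, carrier G})"
proof -
  let ?P = "periodic_configs G A N"
  have NG: "N \<subseteq> carrier G" using N normal_imp_subgroup subgroup.subset by blast
  define c where "c = (\<lambda>g\<in>carrier G. a)"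
  have cc: "c \<in> configs G A" using A by (auto simp: c_def configs_def)
  have shc: "shift G g c = c" if "g \<in> carrier G" for g
    using that by (auto simp: c_def shift_def)
  then have stc: "shift_stabilizer G c = carrier G" by (auto simp: shift_stabilizer_def)
  then have cP: "c \<in> ?P" using cc NG by (simp add: periodic_configs_def)
  define F where "F x = (if shift_stabilizer G x = H then c else x)" for x :: "'a \<Rightarrow> 'c"
  have "\<exists>\<tau>. cellular_automaton G A \<tau> \<and> (\<forall>x\<in>?P. \<tau> x = F x)"
  proof (rule ex_cellular_automaton_extending[OF N S bspec[OF NS] A(1)])
    show "F x \<in> configs G A" if "x \<in> ?P" for x
      using that cc by (simp add: F_def periodic_configs_def)
    fix g x assume g: "g \<in> carrier G" and "x \<in> ?P"
    then have x: "x \<in> configs G A" by (simp add: periodic_configs_def)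
    have "shift_stabilizer G (shift G g x) = H \<longleftrightarrow> shift_stabilizer G x = H"
    proof
      assume *: "shift_stabilizer G (shift G g x) = H"
      then show "shift_stabilizer G x = H"
        using shift_stabilizer_shift_normal[OF shift_closed[OF is_group g x] inv_closed[OF g]] H(1)
        by (simp add: shift_inv_shift[OF x g])
    qed (use shift_stabilizer_shift_normal[OF x g] H(1) in simp)
    then show "F (shift G g x) = shift G g (F x)" using g by (simp add: F_def shc)
  qed
  then obtain \<tau> where \<tau>: "cellular_automaton G A \<tau>" "\<And>x. x \<in> ?P \<Longrightarrow> \<tau> x = F x" by blast
  obtain x where x: "x \<in> configs G A" "shift_stabilizer G x = H"
    using ex_config_shift_stabilizer[OF A normal_imp_subgroup[OF H(1)]] by blast
  then have xP: "x \<in> ?P" using H(2) by (simp add: periodic_configs_def)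
  have "x \<noteq> c" using x stc H(3) by auto
  moreover have "\<tau> x = \<tau> c" using x stc cP xP H(3) by (simp add: \<tau> F_def)
  ultimately have "\<not> inj_on \<tau> ?P" using xP cP by (auto dest: inj_onD)
  moreover have "H \<in> {shift_stabilizer G u, shift_stabilizer G v} \<and>
      {shift_stabilizer G u, shift_stabilizer G v} \<subseteq> {H, carrier G}"
    if "u \<in> ?P" "v \<in> ?P" "u \<noteq> v" "\<tau> u = \<tau> v" for u v
    using that stc by (auto simp: \<tau> F_def split: if_splits)
  ultimately show ?thesis using \<tau>(1) by blast
qed

theorem not_finitely_generated_CA:
  assumes A: "finite A" "2 \<le> card A"
    and inf: "infinite {H. H \<lhd> G \<and> finite (rcosets H)}"
  shows "\<not> finitely_generated_monoid (CA G A)"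
proof
  assume "finitely_generated_monoid (CA G A)"
  then obtain X where X: "finite X" "generated_submonoid (CA G A) X = carrier (CA G A)"
    and XC: "X \<subseteq> carrier (CA G A)"
    by (auto simp: finitely_generated_monoid_def)
  obtain a b where ab: "a \<in> A" "b \<in> A" "a \<noteq> b"
    using A by (metis card_2_iff' card_le_Suc0_iff_eq not_less_eq_eq numeral_2_eq_2)
  have "infinite ({H. H \<lhd> G \<and> finite (rcosets H)} - {carrier G})" using inf by simp
  \<comment> \<open>One subgroup more than there are generators. In particular the family is
    nonempty, so its intersection is a normal subgroup.\<close>
  then obtain \<H> where \<H>: "finite \<H>" "card \<H> = Suc (card X)"
    and sub: "\<H> \<subseteq> {H. H \<lhd> G \<and> finite (rcosets H)} - {carrier G}"
    using infinite_arbitrarily_large by blast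
  define N where "N = \<Inter>\<H>"
  have N: "N \<lhd> G" unfolding N_def using \<H> sub by (intro normal_Inter) auto
  obtain S where S: "finite S" "S \<subseteq> carrier G" "\<forall>g\<in>carrier G. \<exists>s\<in>S. g \<otimes> inv s \<in> N"
  proof -
    have "subgroup H G \<and> finite (rcosets H)" if "H \<in> \<H>" for H
      using that sub normal_imp_subgroup by blast
    from finite_transversal_Inter[OF \<H>(1) this] show ?thesis
      using that unfolding N_def by blast
  qed
  let ?P = "periodic_configs G A N"
  have fin: "finite ?P" using finite_periodic_configs[OF A(1) S(1,2) bspec[OF S(3)]] .
  define good where "good H U V \<longleftrightarrow> H \<in> {U, V} \<and> {U, V} \<subseteq> {H, carrier G}" for H U V :: "'a set"
  define M where "M H = {\<tau>. cellular_automaton G A \<tau> \<and> (inj_on \<tau> ?P \<or>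
    (\<exists>x\<in>?P. \<exists>y\<in>?P. x \<noteq> y \<and> \<tau> x = \<tau> y \<and>
      \<not> good H (shift_stabilizer G x) (shift_stabilizer G y)))}" for H
  have "\<exists>s\<in>X. s \<notin> M H" if H: "H \<in> \<H>" for H
  proof (rule ccontr)
    assume "\<not> ?thesis"
    then have "X \<subseteq> M H" by blast
    then have MH: "carrier (CA G A) \<subseteq> M H"
      using generated_submonoid_subset[of "M H" "CA G A" X] X(2)
        submonoid_kernel_pair[OF N fin, of "\<lambda>U V. \<not> good H U V"]
      by (simp add: M_def)
    have H': "H \<lhd> G" "N \<subseteq> H" "H \<noteq> carrier G" using H sub by (auto simp: N_def)
    obtain \<tau> where "cellular_automaton G A \<tau>" "\<not> inj_on \<tau> ?P"
      "\<forall>x\<in>?P. \<forall>y\<in>?P. x \<noteq> y \<longrightarrow> \<tau> x = \<tau> y \<longrightarrow>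
        good H (shift_stabilizer G x) (shift_stabilizer G y)"
      using ex_collapsing_cellular_automaton[OF ab N S H'] unfolding good_def by blast
    then show False using MH by (auto simp: M_def CA_def)
  qed
  then obtain s where s: "\<And>H. H \<in> \<H> \<Longrightarrow> s H \<in> X \<and> s H \<notin> M H" by metis
  have "inj_on s \<H>"
  proof (rule inj_onI)
    fix H K assume HK: "H \<in> \<H>" "K \<in> \<H>" "s H = s K"
    have "cellular_automaton G A (s H)" using s HK(1) XC by (auto simp: CA_def)
    \<comment> \<open>Lying outside \<open>M H\<close> forces non-injectivity, and the same
      identified pair can be tested against both \<open>H\<close> and \<open>K\<close> since
      \<open>s H = s K\<close>.\<close>
    then obtain x y where "x \<in> ?P" "y \<in> ?P" "x \<noteq> y" "s H x = s H y"
      using s[OF HK(1)] unfolding M_def inj_on_def by blast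
    then have "good H (shift_stabilizer G x) (shift_stabilizer G y)"
      "good K (shift_stabilizer G x) (shift_stabilizer G y)"
      using s[OF HK(1)] s[OF HK(2)] HK(3) XC by (auto simp: M_def CA_def)
    \<comment> \<open>A good pair of stabilizers determines its subgroup as the only member
      different from \<open>carrier G\<close>.\<close>
    then show "H = K" using HK sub by (auto simp: good_def)
  qed
  then have "card \<H> \<le> card X" using s X(1) by (intro card_inj_on_le) auto
  then show False using \<H> by simp
qed

end


section \<open>Finite dihedral quotients of the infinite dihedral group\<close>

text \<open>The dihedral group of order \<open>2n\<close>: the pair \<open>(e, c)\<close> stands for the map
  \<open>k \<mapsto> e k + c\<close> on the integers modulo \<open>n\<close>.\<close>

definition dihedral_group :: "int \<Rightarrow> (int \<times> int) monoid" where
  "dihedral_group n =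
    \<lparr>carrier = {1, -1} \<times> {0..<n},
     mult = (\<lambda>(e, c) (e', c'). (e * e', (e * c' + c) mod n)),
     one = (1, 0)\<rparr>"

lemma dihedral_group_simps:
  "(e, c) \<otimes>\<^bsub>dihedral_group n\<^esub> (e', c') = (e * e', (e * c' + c) mod n)"
  "\<one>\<^bsub>dihedral_group n\<^esub> = (1, 0)"
  by (simp_all add: dihedral_group_def)

lemma group_dihedral_group:
  assumes "n > 0"
  shows "group (dihedral_group n)"
proof (rule groupI)
  let ?D = "dihedral_group n"
  show "\<one>\<^bsub>?D\<^esub> \<in> carrier ?D" using assms by (simp add: dihedral_group_def)
  show "x \<otimes>\<^bsub>?D\<^esub> y \<in> carrier ?D" if "x \<in> carrier ?D" "y \<in> carrier ?D" for x y
    using that assms by (auto simp: dihedral_group_def)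
  show "x \<otimes>\<^bsub>?D\<^esub> y \<otimes>\<^bsub>?D\<^esub> z = x \<otimes>\<^bsub>?D\<^esub> (y \<otimes>\<^bsub>?D\<^esub> z)"
    if "x \<in> carrier ?D" "y \<in> carrier ?D" "z \<in> carrier ?D" for x y z
    using that by (auto simp: dihedral_group_def algebra_simps mod_simps)
  show "\<one>\<^bsub>?D\<^esub> \<otimes>\<^bsub>?D\<^esub> x = x" if "x \<in> carrier ?D" for x
    using that by (auto simp: dihedral_group_def)
  show "\<exists>y\<in>carrier ?D. y \<otimes>\<^bsub>?D\<^esub> x = \<one>\<^bsub>?D\<^esub>" if "x \<in> carrier ?D" for x
  proof -
    obtain e c where x: "x = (e, c)" by fastforce
    \<comment> \<open>Here \<open>e * e = 1\<close>, so the second component of the product is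
      \<open>e * c - e * c\<close> modulo \<open>n\<close>.\<close>
    then have "(e, (- e * c) mod n) \<in> carrier ?D"
      "(e, (- e * c) mod n) \<otimes>\<^bsub>?D\<^esub> x = \<one>\<^bsub>?D\<^esub>"
      using that assms by (auto simp: dihedral_group_def mod_simps)
    then show ?thesis by blast
  qed
qed

section \<open>Homomorphisms out of a presented group\<close>

definition gword_eval :: "('g, 'm) monoid_scheme \<Rightarrow> ('a \<Rightarrow> 'g) \<Rightarrow> 'a gword \<Rightarrow> 'g" where
  "gword_eval G f w =
    foldr (\<lambda>(a, b) g. (if b then f a else inv\<^bsub>G\<^esub> (f a)) \<otimes>\<^bsub>G\<^esub> g) w \<one>\<^bsub>G\<^esub>"

context group
begin

lemma gword_eval_simps:
  "gword_eval G f [] = \<one>"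
  "gword_eval G f ((a, b) # w) = (if b then f a else inv (f a)) \<otimes> gword_eval G f w"
  by (simp_all add: gword_eval_def)

lemma gword_eval_closed:
  assumes "range f \<subseteq> carrier G"
  shows "gword_eval G f w \<in> carrier G"
  using assms by (induction w) (auto simp: gword_eval_simps image_subset_iff)

lemma gword_eval_append:
  assumes "range f \<subseteq> carrier G"
  shows "gword_eval G f (u @ v) = gword_eval G f u \<otimes> gword_eval G f v"
  using assms
  by (induction u) (auto simp: gword_eval_simps image_subset_iff gword_eval_closed m_assoc)

lemma gword_eval_gword_eq:
  assumes f: "range f \<subseteq> carrier G" and R: "\<And>r. r \<in> R \<Longrightarrow> gword_eval G f r = \<one>"
    and "gword_eq R u v"
  shows "gword_eval G f u = gword_eval G f v"
  using assms(3)
proof induction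
  case (cancel u a b v)
  then show ?case
    using f by (cases b) (auto simp: gword_eval_append gword_eval_simps gword_eval_closed
        image_subset_iff mult_inv_cancel_left)
next
  case (relator r u v)
  then show ?case using f R by (simp add: gword_eval_append gword_eval_closed)
qed simp_all

text \<open>Von Dyck's theorem. The map evaluates a chosen representative of the class; the choice
  is harmless because evaluation respects both free cancellation and relators.\<close>

lemma ex_presented_group_hom:
  assumes f: "range f \<subseteq> carrier G" and R: "\<And>r. r \<in> R \<Longrightarrow> gword_eval G f r = \<one>"
  shows "\<exists>\<phi>. group_hom (presented_group R) G \<phi> \<and>
    (\<forall>w. \<phi> (gword_rel R `` {w}) = gword_eval G f w)"
proof -
  define \<phi> where "\<phi> U = gword_eval G f (SOME w. w \<in> U)" for U
  have \<phi>: "\<phi> (gword_rel R `` {w}) = gword_eval G f w" for w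
  proof -
    have "w \<in> gword_rel R `` {w}" by (simp add: gword_rel_def gword_eq.refl)
    then have "(SOME v. v \<in> gword_rel R `` {w}) \<in> gword_rel R `` {w}" by (rule someI)
    then have "gword_eq R w (SOME v. v \<in> gword_rel R `` {w})" by (simp add: gword_rel_def)
    then show ?thesis using gword_eval_gword_eq[OF f R] by (simp add: \<phi>_def)
  qed
  have carr: "\<exists>u. U = gword_rel R `` {u}" if "U \<in> carrier (presented_group R)" for U
    using that by (auto simp: presented_group_def elim: quotientE)
  have "\<phi> \<in> hom (presented_group R) G"
  proof (rule homI)
    fix U V assume "U \<in> carrier (presented_group R)" "V \<in> carrier (presented_group R)"
    then obtain u v where "U = gword_rel R `` {u}" "V = gword_rel R `` {v}" using carr by meson
    then show "\<phi> U \<in> carrier G" "\<phi> (U \<otimes>\<^bsub>presented_group R\<^esub> V) = \<phi> U \<otimes> \<phi> V"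
      by (simp_all add: \<phi> presented_group_mult_class gword_eval_append gword_eval_closed f)
  qed
  then have "group_hom (presented_group R) G \<phi>"
    by (simp add: group_hom_def group_hom_axioms_def group_presented_group is_group)
  then show ?thesis using \<phi> by blast
qed

end

text \<open>By the first isomorphism theorem the cosets of the kernel embed into the finite
  target.\<close>

lemma (in group_hom) finite_rcosets_kernel:
  assumes "finite (carrier H)"
  shows "finite (rcosets\<^bsub>G\<^esub> (kernel G H h))"
proof (rule inj_on_finite)
  show "inj_on (\<lambda>X. the_elem (h ` X)) (rcosets\<^bsub>G\<^esub> (kernel G H h))"
    using FactGroup_inj_on by (simp add: FactGroup_def)
  show "(\<lambda>X. the_elem (h ` X)) ` (rcosets\<^bsub>G\<^esub> (kernel G H h)) \<subseteq> carrier H"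
    using FactGroup_the_elem_mem by (auto simp: FactGroup_def)
qed (rule assms)

section \<open>Infinitely many normal subgroups of finite index in \<open>D_infinity\<close>\<close>

abbreviation D_infinity_class :: "dih_gen gword \<Rightarrow> dih_gen gword set" where
  "D_infinity_class w \<equiv>
    gword_rel {[(Gen_x, True), (Gen_x, True)], [(Gen_y, True), (Gen_y, True)]} `` {w}"

text \<open>The generators go to the reflections \<open>k \<mapsto> - k\<close> and
  \<open>k \<mapsto> 1 - k\<close>. Their product \<open>yx\<close> goes to the rotation
  \<open>k \<mapsto> k + 1\<close>, so its powers count modulo \<open>n\<close>.\<close>

lemma ex_D_infinity_hom_dihedral_group:
  assumes n: "n > 0"
  shows "\<exists>\<phi>. group_hom D_infinity (dihedral_group n) \<phi> \<and>
    (\<forall>m. \<phi> (D_infinity_class (concat (replicate m [(Gen_y, True), (Gen_x, True)])))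
      = (1, int m mod n))"
proof -
  let ?D = "dihedral_group n"
  interpret D: group ?D using group_dihedral_group[OF n] .
  \<comment> \<open>Writing \<open>1 mod n\<close> keeps the pair in the carrier also for
    \<open>n = 1\<close>.\<close>
  define f where "f a = (case a of Gen_x \<Rightarrow> (-1 :: int, 0) | Gen_y \<Rightarrow> (-1, 1 mod n))" for a :: dih_gen
  have f: "range f \<subseteq> carrier ?D"
    using n by (auto simp: f_def dihedral_group_def split: dih_gen.splits)
  have R: "gword_eval ?D f r = \<one>\<^bsub>?D\<^esub>"
    if "r \<in> {[(Gen_x, True), (Gen_x, True)], [(Gen_y, True), (Gen_y, True)]}" for r
    using that by (auto simp: D.gword_eval_simps f_def dihedral_group_simps mod_simps)
  obtain \<phi> where \<phi>: "group_hom D_infinity ?D \<phi>"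
    and ev: "\<And>w. \<phi> (D_infinity_class w) = gword_eval ?D f w"
    using D.ex_presented_group_hom[OF f R] unfolding D_infinity_def by blast
  have "gword_eval ?D f (concat (replicate m [(Gen_y, True), (Gen_x, True)])) = (1, int m mod n)"
    for m
    by (induction m) (simp_all add: D.gword_eval_simps f_def dihedral_group_simps mod_simps)
  then show ?thesis using \<phi> ev by auto
qed

text \<open>The kernels are told apart by the powers of \<open>yx\<close> they contain: the
  \<open>m\<close>-th power lies in the kernel of index \<open>n\<close> in the sequence exactly
  when \<open>Suc n\<close> divides \<open>m\<close>. The successor keeps the modulus
  positive.\<close>

lemma infinite_normal_subgroups_D_infinity:
  "infinite {H. H \<lhd> D_infinity \<and> finite (rcosets\<^bsub>D_infinity\<^esub> H)}"
proof -
  let ?w = "\<lambda>m. D_infinity_class (concat (replicate m [(Gen_y, True), (Gen_x, True)]))"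
  have w: "?w m \<in> carrier D_infinity" for m
    by (simp add: D_infinity_def presented_group_def quotientI)
  have "\<exists>H. H \<lhd> D_infinity \<and> finite (rcosets\<^bsub>D_infinity\<^esub> H) \<and> (\<forall>m. ?w m \<in> H \<longleftrightarrow> Suc n dvd m)" for n
  proof -
    let ?D = "dihedral_group (int (Suc n))"
    obtain \<phi> where "group_hom D_infinity ?D \<phi>" and \<phi>: "\<And>m. \<phi> (?w m) = (1, int m mod int (Suc n))"
      using ex_D_infinity_hom_dihedral_group[of "int (Suc n)"] by auto
    then interpret group_hom D_infinity ?D \<phi> by simp
    have "?w m \<in> kernel D_infinity ?D \<phi> \<longleftrightarrow> Suc n dvd m" for m
    proof -
      have "?w m \<in> kernel D_infinity ?D \<phi> \<longleftrightarrow> int m mod int (Suc n) = 0"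
        using w[of m] \<phi>[of m] by (simp add: kernel_def dihedral_group_def del: of_nat_Suc)
      also have "\<dots> \<longleftrightarrow> Suc n dvd m" by presburger
      finally show ?thesis .
    qed
    moreover have "finite (carrier ?D)" by (simp add: dihedral_group_def)
    ultimately show ?thesis using normal_kernel finite_rcosets_kernel by blast
  qed
  then obtain K where K: "\<And>n. K n \<lhd> D_infinity \<and> finite (rcosets\<^bsub>D_infinity\<^esub> (K n))"
    and Kw: "\<And>n m. ?w m \<in> K n \<longleftrightarrow> Suc n dvd m"
    by metis
  \<comment> \<open>If two kernels agree, testing the powers \<open>Suc n\<close> for both values of
    \<open>n\<close> shows that the two moduli divide each other.\<close>
  have "inj K"
    by (rule injI) (metis Kw dvd_antisym dvd_refl nat.inject)
  then have "infinite (range K)" by (simp add: finite_image_iff)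
  moreover have "range K \<subseteq> {H. H \<lhd> D_infinity \<and> finite (rcosets\<^bsub>D_infinity\<^esub> H)}"
    using K by blast
  ultimately show ?thesis using finite_subset by blast
qed

theorem proposition4:
  fixes A :: "'a set"
  assumes "finite A" and "card A \<ge> 2"
  shows "\<not> finitely_generated_monoid (CA D_infinity A)"
  using group.not_finitely_generated_CA[OF group_D_infinity assms
      infinite_normal_subgroups_D_infinity] .

end
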